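(* Let $V$ be a finite-dimensional vector space over a field $\mathbb{F}$ (of arbitrary characteristic), and let $G \leq \mathrm{GL}(V)$ be a finite group with a polynomial ring of invariants. Then the zero set in $V$ of the Jacobian determinant $J$ of $G$ is the union of all reflecting hyperplanes of $G$.
   Context: Let $n = \dim V \geq 1$. A subgroup $G \leq \mathrm{GL}(V)$ acts on $V$, hence on $V^*$ and on the polynomial ring $\mathbb{F}[V] = \mathrm{Sym}(V^* )$; $\mathbb{F}[V]^G$ is the ring of invariants. A finite group $G$ has a polynomial ring of invariants if $\mathbb{F}[V]^G = \mathbb{F}[f_1,\ldots,f_n]$ for some algebraically independent homogeneous polynomials $f_1,\ldots,f_n$, called basic invariants. In this case the Jacobian determinant of $G$ is $J = J(f_1,\ldots,f_n) = \det(\partial f_i/\partial z_j)$, where $\{z_j\}$ is a basis of $V^*$; it is well defined up to a nonzero scalar in $\mathbb{F}$. For a hyperplane (codimension-one linear subspace) $H$ of $V$, $G_H = \{g \in G : g|_H = \mathrm{id}_H\}$ is its pointwise stabilizer in $G$. The reflecting hyperplanes of $G$ are the hyperplanes $H$ with $G_H$ nontrivial. *)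

theory Defs
  imports
    "HOL-Analysis.Determinants"
    "HOL-Algebra.Group"
    "HOL-Library.Poly_Mapping"
begin

section \<open>Multivariate polynomials as finitely supported maps\<close>

text \<open>
  Polynomials in variables from \<open>'x\<close> with coefficients in \<open>'c\<close>: finitely supported maps
  from exponent vectors to coefficients, with the convolution product of
  \<^theory>\<open>HOL-Library.Poly_Mapping\<close>.  These are formal polynomials, not functions, which
  matters over finite fields.
\<close>

type_synonym ('x, 'c) mpoly = "('x \<Rightarrow>\<^sub>0 nat) \<Rightarrow>\<^sub>0 'c"

definition Const :: "'c::zero \<Rightarrow> ('x, 'c) mpoly" where
  "Const c = Poly_Mapping.single 0 c"

definition Var :: "'x \<Rightarrow> ('x, 'c::zero_neq_one) mpoly" where
  "Var x = Poly_Mapping.single (Poly_Mapping.single x 1) 1"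

text \<open>Evaluation at \<open>s\<close> in an algebra whose structure map is \<open>h\<close>.\<close>

definition mpoly_eval ::
    "('c::zero \<Rightarrow> 'a::comm_ring_1) \<Rightarrow> ('x \<Rightarrow> 'a) \<Rightarrow> ('x, 'c) mpoly \<Rightarrow> 'a" where
  "mpoly_eval h s p =
     (\<Sum>m\<in>Poly_Mapping.keys p.
        h (Poly_Mapping.lookup p m) *
        (\<Prod>x\<in>Poly_Mapping.keys m. s x ^ Poly_Mapping.lookup m x))"

definition mpoly_subst ::
    "('x \<Rightarrow> ('y, 'c) mpoly) \<Rightarrow> ('x, 'c::comm_ring_1) mpoly \<Rightarrow> ('y, 'c) mpoly" where
  "mpoly_subst s p = mpoly_eval Const s p"

text \<open>The natural number subtraction below truncates only when the coefficient is zero.\<close>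

definition mpoly_deriv :: "'x \<Rightarrow> ('x, 'c::comm_ring_1) mpoly \<Rightarrow> ('x, 'c) mpoly" where
  "mpoly_deriv x p =
     (\<Sum>m\<in>Poly_Mapping.keys p.
        Poly_Mapping.single (m - Poly_Mapping.single x 1)
          (of_nat (Poly_Mapping.lookup m x) * Poly_Mapping.lookup p m))"

definition homogeneous :: "('x, 'c::zero) mpoly \<Rightarrow> bool" where
  "homogeneous p \<longleftrightarrow>
     (\<exists>d. \<forall>m\<in>Poly_Mapping.keys p.
        (\<Sum>x\<in>Poly_Mapping.keys m. Poly_Mapping.lookup m x) = d)"

definition algebraically_independent :: "('x \<Rightarrow> ('y, 'c::comm_ring_1) mpoly) \<Rightarrow> bool" where
  "algebraically_independent f \<longleftrightarrow> (\<forall>p. mpoly_subst f p = 0 \<longrightarrow> p = 0)"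


section \<open>The general linear group and reflecting hyperplanes\<close>

definition GL :: "('f::field \<Rightarrow> 'v::ab_group_add \<Rightarrow> 'v) \<Rightarrow> ('v \<Rightarrow> 'v) monoid" where
  "GL sc = \<lparr>carrier = {g. Vector_Spaces.linear sc sc g \<and> bij g},
               monoid.mult = (\<lambda>g h. g \<circ> h), one = id\<rparr>"

lemma group_GL:
  assumes "vector_space sc"
  shows "group (GL sc)"
proof (rule groupI)
  interpret vector_space sc by fact
  interpret vector_space_pair sc sc ..
  show "\<one>\<^bsub>GL sc\<^esub> \<in> carrier (GL sc)"
    by (simp add: GL_def linear_id)
  fix g h assume g: "g \<in> carrier (GL sc)" and h: "h \<in> carrier (GL sc)"
  show "g \<otimes>\<^bsub>GL sc\<^esub> h \<in> carrier (GL sc)"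
    using g h by (auto simp: GL_def bij_comp intro: Vector_Spaces.linear_compose)
next
  interpret vector_space sc by fact
  interpret vector_space_pair sc sc ..
  fix g assume g: "g \<in> carrier (GL sc)"
  then have lin: "Vector_Spaces.linear sc sc g" and bij: "bij g"
    by (auto simp: GL_def)
  have "Vector_Spaces.linear sc sc (inv_into UNIV g)"
  proof -
    interpret Vector_Spaces.linear sc sc g by (rule lin)
    show ?thesis
    proof unfold_locales
      show "inv_into UNIV g (a + b) = inv_into UNIV g a + inv_into UNIV g b" for a b
        by (rule inv_f_eq) (use bij in \<open>auto simp: bij_def add surj_f_inv_f\<close>)
      show "inv_into UNIV g (sc r a) = sc r (inv_into UNIV g a)" for r a
        by (rule inv_f_eq) (use bij in \<open>auto simp: bij_def local.scale surj_f_inv_f\<close>)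
    qed
  qed
  moreover have "inv_into UNIV g \<circ> g = id"
    using bij by (simp add: bij_def)
  ultimately show "\<exists>h\<in>carrier (GL sc). h \<otimes>\<^bsub>GL sc\<^esub> g = \<one>\<^bsub>GL sc\<^esub>"
    using bij by (auto simp: GL_def bij_imp_bij_inv)
qed (auto simp: GL_def comp_assoc)

definition hyperplane ::
    "('f::field \<Rightarrow> 'v::ab_group_add \<Rightarrow> 'v) \<Rightarrow> 'v set \<Rightarrow> bool" where
  "hyperplane sc H \<longleftrightarrow>
     module.subspace sc H \<and> vector_space.dim sc H + 1 = vector_space.dim sc UNIV"

definition pointwise_stabilizer :: "('v \<Rightarrow> 'v) set \<Rightarrow> 'v set \<Rightarrow> ('v \<Rightarrow> 'v) set" where
  "pointwise_stabilizer G H = {g \<in> G. \<forall>v\<in>H. g v = v}"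

definition reflecting_hyperplane ::
    "('f::field \<Rightarrow> 'v::ab_group_add \<Rightarrow> 'v) \<Rightarrow> ('v \<Rightarrow> 'v) set \<Rightarrow> 'v set \<Rightarrow> bool" where
  "reflecting_hyperplane sc G H \<longleftrightarrow>
     hyperplane sc H \<and> pointwise_stabilizer G H \<noteq> {id}"


section \<open>Invariants and the Jacobian determinant\<close>

text \<open>
  Let \<open>e\<close> be an injectively indexed basis of \<open>V\<close>.  Its dual basis \<open>coord sc e j\<close> of
  \<open>V\<^sup>*\<close> identifies \<open>Sym(V\<^sup>*)\<close> with the polynomials in variables \<open>'n\<close>, the variable
  \<open>j\<close> standing for the linear form \<open>coord sc e j\<close>.
\<close>

definition coord ::
    "('f::field \<Rightarrow> 'v::ab_group_add \<Rightarrow> 'v) \<Rightarrow> ('n \<Rightarrow> 'v) \<Rightarrow> 'n \<Rightarrow> 'v \<Rightarrow> 'f" where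
  "coord sc e j v = module.representation sc (range e) v (e j)"

definition form_poly ::
    "('n::finite \<Rightarrow> 'v) \<Rightarrow> ('v \<Rightarrow> 'f::field) \<Rightarrow> ('n, 'f) mpoly" where
  "form_poly e l = (\<Sum>i\<in>UNIV. Const (l (e i)) * Var i)"

text \<open>
  The action on \<open>V\<^sup>*\<close> is \<open>(g \<cdot> l) v = l (g\<inverse> v)\<close>, extended to polynomials by algebra
  automorphisms.
\<close>

definition poly_action ::
    "('f::field \<Rightarrow> 'v::ab_group_add \<Rightarrow> 'v) \<Rightarrow> ('n::finite \<Rightarrow> 'v) \<Rightarrow>
     ('v \<Rightarrow> 'v) \<Rightarrow> ('n, 'f) mpoly \<Rightarrow> ('n, 'f) mpoly" where
  "poly_action sc e g p =
     mpoly_subst (\<lambda>j. form_poly e (\<lambda>v. coord sc e j (inv_into UNIV g v))) p"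

definition invariants ::
    "('f::field \<Rightarrow> 'v::ab_group_add \<Rightarrow> 'v) \<Rightarrow> ('n::finite \<Rightarrow> 'v) \<Rightarrow>
     ('v \<Rightarrow> 'v) set \<Rightarrow> ('n, 'f) mpoly set" where
  "invariants sc e G = {p. \<forall>g\<in>G. poly_action sc e g p = p}"

definition basic_invariants ::
    "('f::field \<Rightarrow> 'v::ab_group_add \<Rightarrow> 'v) \<Rightarrow> ('n::finite \<Rightarrow> 'v) \<Rightarrow>
     ('v \<Rightarrow> 'v) set \<Rightarrow> ('n \<Rightarrow> ('n, 'f) mpoly) \<Rightarrow> bool" where
  "basic_invariants sc e G f \<longleftrightarrow>
     (\<forall>i. homogeneous (f i)) \<and> algebraically_independent f \<and>
     invariants sc e G = range (mpoly_subst f)"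

definition jacobian_det :: "('n::finite \<Rightarrow> ('n, 'f::field) mpoly) \<Rightarrow> ('n, 'f) mpoly" where
  "jacobian_det f = det (\<chi> i j. mpoly_deriv j (f i))"

definition zero_set ::
    "('f::field \<Rightarrow> 'v::ab_group_add \<Rightarrow> 'v) \<Rightarrow> ('n \<Rightarrow> 'v) \<Rightarrow> ('n, 'f) mpoly \<Rightarrow> 'v set" where
  "zero_set sc e p = {v. mpoly_eval (\<lambda>c. c) (\<lambda>j. coord sc e j v) p = 0}"

end

theory Submission
  imports Defs "HOL-Computational_Algebra.Factorial_Ring"
begin

text \<open>
  Write \<open>S\<close> for the polynomial ring, \<open>x\<close> for the generic point (the tuple of variables),
  \<open>A\<close> for the matrix of partial derivatives \<open>\<partial>\<^sub>j f\<^sub>i\<close> and \<open>J\<close> for its determinant.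

  Suppose that \<open>g \<noteq> 1\<close> in \<open>G\<close> fixes \<open>v\<close>.  Differentiating \<open>g \<cdot> f\<^sub>i = f\<^sub>i\<close> at \<open>v\<close> gives
  \<open>A(v) = A(v) C\<close>, where \<open>C \<noteq> 1\<close> is the matrix of the inverse of \<open>g\<close>, so \<open>A(v)\<close> is singular.
  This shows that \<open>J\<close> vanishes on the reflecting hyperplanes
  (\<open>jacobian_det_zero_at_fixed_point\<close>).

  The converse rests on \<open>jacobian_det_dvd\<close>: if a coordinate \<open>k(h)\<close> is chosen arbitrarily for each
  \<open>h \<noteq> 1\<close> in \<open>G\<close>, then \<open>J\<close> divides a power of the product of the linear forms
  \<open>x\<^sub>k - h \<cdot> x\<^sub>k\<close> with \<open>k = k(h)\<close>.  To see this, consider the trace of a polynomial \<open>p\<close>, the sum of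
  \<open>g \<cdot> p\<close> over \<open>g \<in> G\<close>.  It is invariant, hence a polynomial in the \<open>f\<^sub>i\<close>, and by the chain rule
  its gradient lies in the \<open>S\<close>-module spanned by the rows of \<open>A\<close>.  So do all \<open>S\<close>-linear
  combinations of such gradients, and they contain, for any polynomial \<open>q\<close> with coefficients in \<open>S\<close>,
  the sum over \<open>g\<close> of the derivative of \<open>q(g \<cdot> x)\<close> taken with the coefficients of \<open>q\<close> held constant.
  Multiplying \<open>z\<^sub>m - x\<^sub>m\<close> by the squares of all \<open>z\<^sub>k - h \<cdot> x\<^sub>k\<close> with \<open>k = k(h)\<close> gives a \<open>q(z)\<close> that
  vanishes to second order at every \<open>h \<cdot> x\<close> with \<open>h \<noteq> 1\<close>.  Only the term of \<open>g = 1\<close> survives, and it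
  is \<open>d\<close> times the \<open>m\<close>-th unit vector, where \<open>d\<close> is the product of the squares of the
  \<open>x\<^sub>k - h \<cdot> x\<^sub>k\<close>.  Hence \<open>B A = d I\<close> for some matrix \<open>B\<close> over \<open>S\<close>, and \<open>J\<close> divides the determinant
  of the right-hand side.

  Nonzero linear forms are prime elements of \<open>S\<close> (\<open>linear_form_prime_elem\<close>).  Choose \<open>k\<close> so that all
  \<open>x\<^sub>k - h \<cdot> x\<^sub>k\<close> are nonzero.  If \<open>J(v) = 0\<close>, then one of these forms, say \<open>\<pi>\<close>, vanishes at \<open>v\<close> and
  divides \<open>J\<close>.  Now \<open>\<pi>\<close> divides the products that belong to all the other choices of \<open>k\<close> as well.
  This is only possible if some \<open>g \<noteq> 1\<close> is such that \<open>\<pi>\<close> divides \<open>x\<^sub>k - g \<cdot> x\<^sub>k\<close> for every \<open>k\<close>.  Such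
  a \<open>g\<close> fixes the kernel of \<open>\<pi>\<close> pointwise, and this kernel is a hyperplane through \<open>v\<close>.
\<close>

section \<open>Evaluation and induction for polynomials\<close>

lemma sum_of_monomials:
  fixes p :: "('x, 'c::comm_ring_1) mpoly"
  shows "p = (\<Sum>m\<in>Poly_Mapping.keys p. Poly_Mapping.single m (Poly_Mapping.lookup p m))"
  by (rule poly_mapping_eqI)
     (auto simp: lookup_sum lookup_single when_def in_keys_iff)

lemma Const_0 [simp]: "Const 0 = 0"
  and Const_1 [simp]: "Const 1 = 1"
  and Const_add: "Const (a + b) = Const a + Const b"
  and Const_mult: "Const (a * b) = Const a * Const b"
  by (simp_all add: Const_def single_add mult_single)

lemma Const_diff: "Const (a - b) = Const a - Const (b :: 'c::comm_ring_1)"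
  by (simp add: Const_def single_diff)

lemma Const_sum: "Const (\<Sum>i\<in>I. F i) = (\<Sum>i\<in>I. Const (F i :: 'c::comm_ring_1))"
  by (induction I rule: infinite_finite_induct) (simp_all add: Const_add)

lemma Var_power: "Var x ^ n = Poly_Mapping.single (Poly_Mapping.single x n) 1"
  by (induction n) (simp_all add: Var_def mult_single flip: single_add)

lemma mpoly_induct [case_names Const Var add mult]:
  fixes p :: "('x, 'c::comm_ring_1) mpoly"
  assumes Const: "\<And>c. P (Const c)" and Var: "\<And>x. P (Var x)"
    and add: "\<And>p q. P p \<Longrightarrow> P q \<Longrightarrow> P (p + q)"
    and mult: "\<And>p q. P p \<Longrightarrow> P q \<Longrightarrow> P (p * q)"
  shows "P p"
proof -
  have one: "P 1" and zero: "P 0"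
    using Const[of 1] Const[of 0] by simp_all
  have pow: "P (Var x ^ n)" for x n
    by (induction n) (simp_all add: one mult[OF Var])
  have mono: "P (Poly_Mapping.single m 1)" for m :: "'x \<Rightarrow>\<^sub>0 nat"
  proof (induction m rule: update_induct)
    case const
    then show ?case by (simp add: one)
  next
    case (update f a b)
    then have "Poly_Mapping.update a b f = f + Poly_Mapping.single a b"
      by (intro poly_mapping_eqI)
         (auto simp: lookup_update lookup_add lookup_single when_def in_keys_iff)
    then have "Poly_Mapping.single (Poly_Mapping.update a b f) (1::'c) =
        Poly_Mapping.single f 1 * Var a ^ b"
      by (simp add: Var_power mult_single)
    then show ?case
      using update mult pow by simp
  qed
  have single: "P (Poly_Mapping.single m c)" for m c
    using mult[OF Const[of c] mono[of m]] by (simp add: Const_def mult_single)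
  have "P (\<Sum>m\<in>M. Poly_Mapping.single m (Poly_Mapping.lookup p m))" for M
    by (induction M rule: infinite_finite_induct) (simp_all add: zero add single)
  from this[of "Poly_Mapping.keys p"] show ?thesis
    by (simp only: sum_of_monomials[of p, symmetric])
qed

text \<open>
  Evaluation is used with two structure maps: \<open>Const\<close>, which makes it substitution of polynomials, and
  the identity, which makes it the value of a polynomial at a point.
\<close>

locale coefficient_hom =
  fixes h :: "'c::comm_ring_1 \<Rightarrow> 'a::comm_ring_1"
  assumes zero: "h 0 = 0" and one: "h 1 = 1"
    and add: "h (a + b) = h a + h b" and mult: "h (a * b) = h a * h b"
begin

lemma eval_superset:
  assumes "finite M" and "Poly_Mapping.keys p \<subseteq> M"
  shows "mpoly_eval h s p =
    (\<Sum>m\<in>M. h (Poly_Mapping.lookup p m) *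
      (\<Prod>x\<in>Poly_Mapping.keys m. s x ^ Poly_Mapping.lookup m x))"
  unfolding mpoly_eval_def using assms
  by (intro sum.mono_neutral_left) (auto simp: in_keys_iff zero)

lemma eval_add [simp]: "mpoly_eval h s (p + q) = mpoly_eval h s p + mpoly_eval h s q"
proof -
  let ?M = "Poly_Mapping.keys p \<union> Poly_Mapping.keys q"
  have "Poly_Mapping.keys (p + q) \<subseteq> ?M"
    by (rule keys_add)
  then show ?thesis
    by (simp add: eval_superset[of ?M] lookup_add add distrib_right sum.distrib)
qed

lemma eval_0 [simp]: "mpoly_eval h s 0 = 0"
  by (simp add: mpoly_eval_def)

lemma eval_sum [simp]: "mpoly_eval h s (\<Sum>i\<in>I. F i) = (\<Sum>i\<in>I. mpoly_eval h s (F i))"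
  by (induction I rule: infinite_finite_induct) simp_all

lemma eval_single:
  "mpoly_eval h s (Poly_Mapping.single m c) =
    h c * (\<Prod>x\<in>Poly_Mapping.keys m. s x ^ Poly_Mapping.lookup m x)"
  by (subst eval_superset[of "{m}"]) (auto simp: zero)

lemma eval_Const [simp]: "mpoly_eval h s (Const c) = h c"
  by (simp add: Const_def eval_single)

lemma eval_1 [simp]: "mpoly_eval h s 1 = 1"
  using eval_Const[of s 1] by (simp add: one)

lemma eval_Var [simp]: "mpoly_eval h s (Var x) = s x"
  by (simp add: Var_def eval_single one)

lemma monomial_add:
  "(\<Prod>x\<in>Poly_Mapping.keys (m + n). s x ^ Poly_Mapping.lookup (m + n) x) =
   (\<Prod>x\<in>Poly_Mapping.keys m. s x ^ Poly_Mapping.lookup m x) *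
   (\<Prod>x\<in>Poly_Mapping.keys n. (s x :: 'a) ^ Poly_Mapping.lookup n x)"
proof -
  let ?M = "Poly_Mapping.keys m \<union> Poly_Mapping.keys n"
  have *: "(\<Prod>x\<in>Poly_Mapping.keys k. s x ^ Poly_Mapping.lookup k x) =
      (\<Prod>x\<in>?M. s x ^ Poly_Mapping.lookup k x)" if "Poly_Mapping.keys k \<subseteq> ?M" for k
    using that by (intro prod.mono_neutral_left) (auto simp: in_keys_iff)
  show ?thesis
    unfolding *[OF keys_add] *[OF Un_upper1] *[OF Un_upper2]
    by (simp only: lookup_add power_add prod.distrib)
qed

lemma eval_mult [simp]: "mpoly_eval h s (p * q) = mpoly_eval h s p * mpoly_eval h s q"
proof -
  have "p * q = (\<Sum>m\<in>Poly_Mapping.keys p. \<Sum>n\<in>Poly_Mapping.keys q.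
      Poly_Mapping.single (m + n) (Poly_Mapping.lookup p m * Poly_Mapping.lookup q n))"
    using arg_cong2[OF sum_of_monomials[of p] sum_of_monomials[of q], of "(*)"]
    by (simp only: sum_product mult_single)
  then have "mpoly_eval h s (p * q) = (\<Sum>m\<in>Poly_Mapping.keys p. \<Sum>n\<in>Poly_Mapping.keys q.
      (h (Poly_Mapping.lookup p m) * (\<Prod>x\<in>Poly_Mapping.keys m. s x ^ Poly_Mapping.lookup m x)) *
      (h (Poly_Mapping.lookup q n) * (\<Prod>x\<in>Poly_Mapping.keys n. s x ^ Poly_Mapping.lookup n x)))"
    by (simp add: eval_single mult monomial_add mult_ac)
  then show ?thesis
    by (simp add: mpoly_eval_def sum_product)
qed

lemma eval_uminus [simp]: "mpoly_eval h s (- p) = - mpoly_eval h s p"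
  using eval_add[of s p "- p"] by (simp add: eq_neg_iff_add_eq_0 add.commute)

lemma eval_diff [simp]: "mpoly_eval h s (p - q) = mpoly_eval h s p - mpoly_eval h s q"
  using eval_add[of s p "- q"] by simp

lemma eval_prod [simp]: "mpoly_eval h s (\<Prod>i\<in>I. F i) = (\<Prod>i\<in>I. mpoly_eval h s (F i))"
  by (induction I rule: infinite_finite_induct) simp_all

text \<open>
  The sign of a permutation enters a determinant as the image of an integer.
\<close>

lemma eval_of_int [simp]: "mpoly_eval h s (of_int k) = of_int k"
proof -
  have nat: "mpoly_eval h s (of_nat n) = of_nat n" for n
    by (induction n) simp_all
  show ?thesis
    by (cases k rule: int_cases2) (simp_all add: nat)
qed

lemma eval_det:
  fixes A :: "('x, 'c) mpoly^'m^'m"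
  shows "mpoly_eval h s (det A) = det (\<chi> i j. mpoly_eval h s (A $ i $ j))"
  by (simp add: det_def)

end

interpretation Const: coefficient_hom Const
  by unfold_locales (simp_all add: Const_add Const_mult)

interpretation ident: coefficient_hom "\<lambda>c::'c::comm_ring_1. c"
  by unfold_locales simp_all

lemmas subst_simps [simp] =
  Const.eval_add[folded mpoly_subst_def] Const.eval_0[folded mpoly_subst_def]
  Const.eval_sum[folded mpoly_subst_def] Const.eval_Const[folded mpoly_subst_def]
  Const.eval_1[folded mpoly_subst_def] Const.eval_Var[folded mpoly_subst_def]
  Const.eval_mult[folded mpoly_subst_def] Const.eval_uminus[folded mpoly_subst_def]
  Const.eval_diff[folded mpoly_subst_def]

lemma eval_subst:
  fixes h :: "'c::comm_ring_1 \<Rightarrow> 'a::comm_ring_1"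
  assumes "coefficient_hom h"
  shows "mpoly_eval h s (mpoly_subst t p) = mpoly_eval h (\<lambda>x. mpoly_eval h s (t x)) p"
proof -
  interpret coefficient_hom h by fact
  show ?thesis by (induction p rule: mpoly_induct) simp_all
qed

lemmas subst_subst = eval_subst[OF Const.coefficient_hom_axioms, folded mpoly_subst_def]

lemma subst_Var [simp]: "mpoly_subst Var p = p"
  by (induction p rule: mpoly_induct) simp_all

section \<open>Formal derivatives\<close>

lemma deriv_superset:
  assumes "finite M" and "Poly_Mapping.keys p \<subseteq> M"
  shows "mpoly_deriv x p = (\<Sum>m\<in>M. Poly_Mapping.single (m - Poly_Mapping.single x 1)
    (of_nat (Poly_Mapping.lookup m x) * Poly_Mapping.lookup p m))"
  unfolding mpoly_deriv_def using assms
  by (intro sum.mono_neutral_left) (auto simp: in_keys_iff)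

lemma deriv_add [simp]: "mpoly_deriv x (p + q) = mpoly_deriv x p + mpoly_deriv x q"
proof -
  let ?M = "Poly_Mapping.keys p \<union> Poly_Mapping.keys q"
  have "Poly_Mapping.keys (p + q) \<subseteq> ?M"
    by (rule keys_add)
  then show ?thesis
    by (simp add: deriv_superset[of ?M] lookup_add single_add distrib_left sum.distrib)
qed

lemma deriv_0 [simp]: "mpoly_deriv x 0 = 0"
  by (simp add: mpoly_deriv_def)

lemma deriv_sum [simp]: "mpoly_deriv x (\<Sum>i\<in>I. F i) = (\<Sum>i\<in>I. mpoly_deriv x (F i))"
  by (induction I rule: infinite_finite_induct) simp_all

lemma deriv_single:
  "mpoly_deriv x (Poly_Mapping.single m c) =
    Poly_Mapping.single (m - Poly_Mapping.single x 1) (of_nat (Poly_Mapping.lookup m x) * c)"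
  by (subst deriv_superset[of "{m}"]) auto

lemma deriv_Const [simp]: "mpoly_deriv x (Const c) = 0"
  by (simp add: Const_def deriv_single)

lemma deriv_1 [simp]: "mpoly_deriv x 1 = 0"
  using deriv_Const[of x 1] by simp

lemma deriv_Var [simp]: "mpoly_deriv x (Var y) = (if x = y then 1 else 0)"
  by (simp add: Var_def deriv_single lookup_single)

lemma deriv_mult_single:
  "mpoly_deriv x (Poly_Mapping.single m a * Poly_Mapping.single n b) =
    mpoly_deriv x (Poly_Mapping.single m a) * Poly_Mapping.single n b +
    Poly_Mapping.single m a * mpoly_deriv x (Poly_Mapping.single n b)"
proof -
  let ?e = "Poly_Mapping.single x 1 :: 'a \<Rightarrow>\<^sub>0 nat"
  \<comment> \<open>Subtraction of exponents truncates only if \<open>x\<close> does not occur in \<open>m\<close>,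
    and then the coefficient vanishes.\<close>
  have shift: "m + n - ?e = (m - ?e) + n" if "Poly_Mapping.lookup m x \<noteq> 0"
    for m n :: "'a \<Rightarrow>\<^sub>0 nat"
    using that by (intro poly_mapping_eqI) (auto simp: lookup_add lookup_minus lookup_single when_def)
  have left: "Poly_Mapping.single (m + n - ?e) (of_nat (Poly_Mapping.lookup m x) * (a * b)) =
      Poly_Mapping.single ((m - ?e) + n) (of_nat (Poly_Mapping.lookup m x) * (a * b))"
    using shift[of m n] by (cases "Poly_Mapping.lookup m x = 0") simp_all
  have right: "Poly_Mapping.single (m + n - ?e) (of_nat (Poly_Mapping.lookup n x) * (a * b)) =
      Poly_Mapping.single (m + (n - ?e)) (of_nat (Poly_Mapping.lookup n x) * (a * b))"
    using shift[of n m] by (cases "Poly_Mapping.lookup n x = 0") (simp_all add: add.commute)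
  have "mpoly_deriv x (Poly_Mapping.single m a * Poly_Mapping.single n b) =
      Poly_Mapping.single (m + n - ?e) (of_nat (Poly_Mapping.lookup m x) * (a * b)) +
      Poly_Mapping.single (m + n - ?e) (of_nat (Poly_Mapping.lookup n x) * (a * b))"
    by (simp only: mult_single deriv_single lookup_add of_nat_add distrib_right single_add)
  then show ?thesis
    unfolding left right by (simp only: mult_single deriv_single mult.assoc mult.left_commute[of a])
qed

lemma deriv_mult [simp]:
  fixes p q :: "('x, 'c::comm_ring_1) mpoly"
  shows "mpoly_deriv x (p * q) = mpoly_deriv x p * q + p * mpoly_deriv x q"
proof -
  define S where "S r m = Poly_Mapping.single m (Poly_Mapping.lookup r m)" 
    for r :: "('x, 'c) mpoly" and m
  have sum: "r = (\<Sum>m\<in>Poly_Mapping.keys r. S r m)" for r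
    unfolding S_def by (rule sum_of_monomials)
  have one: "mpoly_deriv x (S p m * q) = mpoly_deriv x (S p m) * q + S p m * mpoly_deriv x q" for m
  proof -
    have "mpoly_deriv x (S p m * (\<Sum>n\<in>Poly_Mapping.keys q. S q n)) =
        mpoly_deriv x (S p m) * (\<Sum>n\<in>Poly_Mapping.keys q. S q n) +
        S p m * mpoly_deriv x (\<Sum>n\<in>Poly_Mapping.keys q. S q n)"
      by (simp only: sum_distrib_left deriv_sum S_def deriv_mult_single sum.distrib)
    then show ?thesis
      by (simp only: sum[of q, symmetric])
  qed
  have "mpoly_deriv x ((\<Sum>m\<in>Poly_Mapping.keys p. S p m) * q) =
      mpoly_deriv x (\<Sum>m\<in>Poly_Mapping.keys p. S p m) * q +
      (\<Sum>m\<in>Poly_Mapping.keys p. S p m) * mpoly_deriv x q"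
    by (simp only: sum_distrib_right deriv_sum one sum.distrib)
  then show ?thesis
    by (simp only: sum[of p, symmetric])
qed

lemma deriv_subst:
  fixes p :: "('x::finite, 'c::comm_ring_1) mpoly"
  shows "mpoly_deriv j (mpoly_subst s p) =
    (\<Sum>i\<in>UNIV. mpoly_subst s (mpoly_deriv i p) * mpoly_deriv j (s i))"
proof (induction p rule: mpoly_induct)
  case (Var x)
  have "(\<Sum>i\<in>UNIV. mpoly_subst s (mpoly_deriv i (Var x)) * mpoly_deriv j (s i)) =
      (\<Sum>i\<in>UNIV. if i = x then mpoly_deriv j (s i) else 0)"
    by (intro sum.cong) simp_all
  then show ?case by simp
qed (simp_all add: distrib_right distrib_left sum.distrib sum_distrib_left sum_distrib_right mult_ac)

section \<open>Linear forms are prime\<close>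

text \<open>
  If the variables are linearly ordered, products of lexicographic leading terms do not cancel.
  Renaming the variables injectively by natural numbers reduces to that case.
\<close>

lemma mpoly_no_zero_divisors:
  fixes p q :: "('n::finite, 'c::idom) mpoly"
  assumes "p * q = 0"
  shows "p = 0 \<or> q = 0"
proof -
  obtain \<iota> :: "'n \<Rightarrow> nat" where "inj \<iota>"
    using finite_imp_inj_to_nat_seg[of "UNIV :: 'n set"] by auto
  define \<phi> :: "('n, 'c) mpoly \<Rightarrow> (nat, 'c) mpoly" where "\<phi> = mpoly_subst (Var \<circ> \<iota>)"
  have left_inverse: "mpoly_subst (Var \<circ> inv_into UNIV \<iota>) (\<phi> r) = r" for r
    unfolding \<phi>_def using \<open>inj \<iota>\<close> by (simp add: subst_subst)
  have "\<phi> p * \<phi> q = 0"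
    using arg_cong[OF assms, of \<phi>] by (simp add: \<phi>_def)
  then have "\<phi> p = 0 \<or> \<phi> q = 0" by simp
  then show ?thesis
    using left_inverse[of p] left_inverse[of q] by auto
qed

text \<open>
  Solving the equation \<open>l = 0\<close> for a variable that occurs in \<open>l\<close> gives a substitution whose kernel
  is the ideal generated by \<open>l\<close>.  Its values lie in a ring without zero divisors.
\<close>

lemma linear_form_prime_elem:
  fixes a :: "'n::finite \<Rightarrow> 'f::field"
  assumes "a k \<noteq> 0"
  shows "prime_elem (\<Sum>i\<in>UNIV. Const (a i) * Var i :: ('n, 'f) mpoly)" (is "prime_elem ?l")
proof -
  define s where "s = Var(k := Var k - Const (1 / a k) * ?l)"
  have unit: "Const (a k) * Const (1 / a k) = 1"
    using assms by (simp flip: Const_mult)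
  have "mpoly_subst s ?l = (\<Sum>i\<in>UNIV. Const (a i) * Var i
      - (if i = k then Const (a k) * (Const (1 / a k) * ?l) else 0))"
    by (simp, intro sum.cong) (auto simp: s_def algebra_simps)
  also have "\<dots> = ?l - Const (a k) * Const (1 / a k) * ?l"
    by (simp add: sum_subtractf mult.assoc)
  finally have s_l: "mpoly_subst s ?l = 0"
    by (simp add: unit)
  have cong: "?l dvd p - mpoly_subst s p" for p
  proof (induction p rule: mpoly_induct)
    case (mult p q)
    have "p * q - mpoly_subst s (p * q) =
        (p - mpoly_subst s p) * q + mpoly_subst s p * (q - mpoly_subst s q)"
      by (simp add: algebra_simps)
    then show ?case
      using dvd_add[OF dvd_mult2[OF mult(1)] dvd_mult[OF mult(2)]] by (simp only:)
  next
    case (add p q)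
    have "p + q - mpoly_subst s (p + q) = (p - mpoly_subst s p) + (q - mpoly_subst s q)"
      by simp
    then show ?case
      using dvd_add[OF add] by (simp only:)
  qed (simp_all add: s_def)
  have dvd_iff: "?l dvd p \<longleftrightarrow> mpoly_subst s p = 0" for p
  proof
    assume "?l dvd p"
    then show "mpoly_subst s p = 0"
      using s_l by (elim dvdE) simp
  next
    assume "mpoly_subst s p = 0"
    then show "?l dvd p"
      using cong[of p] by simp
  qed
  show ?thesis
  proof (rule prime_elemI)
    have "mpoly_eval (\<lambda>c. c) (\<lambda>i. if i = k then 1 else 0) ?l = a k"
      by (simp add: if_distrib[of "\<lambda>x. a _ * x"] cong: if_cong)
    then show "?l \<noteq> 0"
      using assms ident.eval_0[of "\<lambda>i. if i = k then 1 else 0"] by (metis (no_types))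
    show "\<not> ?l dvd 1" by (simp add: dvd_iff)
    show "?l dvd p \<or> ?l dvd q" if "?l dvd p * q" for p q
      using that mpoly_no_zero_divisors[of "mpoly_subst s p" "mpoly_subst s q"]
      by (simp add: dvd_iff)
  qed
qed

section \<open>Divisors of products of primes\<close>

lemma prime_elem_dvd_prodE:
  fixes \<pi> :: "'a::comm_semiring_1"
  assumes "prime_elem \<pi>" and "\<pi> dvd (\<Prod>i\<in>I. F i)"
  obtains i where "i \<in> I" and "\<pi> dvd F i"
proof -
  have "\<exists>i\<in>I. \<pi> dvd F i"
    using assms(2)
  proof (induction I rule: infinite_finite_induct)
    case (insert i I)
    then show ?case
      using prime_elem_dvd_multD[OF assms(1), of "F i"] by auto
  qed (use assms(1) in \<open>auto simp: prime_elem_def\<close>)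
  then show thesis
    using that by blast
qed

lemma mpoly_mult_left_cancel:
  fixes p q r :: "('n::finite, 'c::idom) mpoly"
  assumes "p * q = p * r" and "p \<noteq> 0"
  shows "q = r"
  using mpoly_no_zero_divisors[of p "q - r"] assms by (simp add: right_diff_distrib)

text \<open>
  A divisor of a product of primes is a unit times the product of some of these primes, so it can
  vanish at a point only if one of them does.  Cancelling the primes one at a time proves this in any
  ring without zero divisors.
\<close>

lemma prime_divisor_at_zero:
  fixes p :: "('n::finite, 'c::idom) mpoly"
  assumes "finite I" and "\<And>i. i \<in> I \<Longrightarrow> prime_elem (\<pi> i)"
    and "p dvd (\<Prod>i\<in>I. \<pi> i)" and "mpoly_eval (\<lambda>c. c) s p = 0"
  shows "\<exists>i\<in>I. \<pi> i dvd p \<and> mpoly_eval (\<lambda>c. c) s (\<pi> i) = 0"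
  using assms
proof (induction I arbitrary: p rule: finite_induct)
  case empty
  then obtain r where "p * r = 1"
    by (metis dvdE prod.empty)
  then have "mpoly_eval (\<lambda>c. c) s p * mpoly_eval (\<lambda>c. c) s r = 1"
    by (metis ident.eval_1 ident.eval_mult)
  with empty show ?case by simp
next
  case (insert i I)
  then have prime: "prime_elem (\<pi> i)" by simp
  then have nz: "\<pi> i \<noteq> 0" by (simp add: prime_elem_def)
  obtain r where r: "\<pi> i * (\<Prod>i\<in>I. \<pi> i) = p * r"
    using insert.prems(2) insert.hyps by (auto elim: dvdE)
  then consider "\<pi> i dvd p" | "\<pi> i dvd r"
    using prime_elem_dvd_multD[OF prime, of p r] by (metis dvd_triv_left)
  then show ?case
  proof cases
    case 1
    then obtain q where q: "p = \<pi> i * q" by (elim dvdE)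
    show ?thesis
    proof (cases "mpoly_eval (\<lambda>c. c) s (\<pi> i) = 0")
      case True
      with 1 show ?thesis by blast
    next
      case False
      then have "mpoly_eval (\<lambda>c. c) s q = 0"
        using insert.prems(3) by (simp add: q)
      moreover have "(\<Prod>i\<in>I. \<pi> i) = q * r"
        using r nz by (auto simp: q mult.assoc dest: mpoly_mult_left_cancel)
      ultimately have "\<exists>i\<in>I. \<pi> i dvd q \<and> mpoly_eval (\<lambda>c. c) s (\<pi> i) = 0"
        using insert.prems(1) by (intro insert.IH) auto
      then show ?thesis
        by (auto simp: q)
    qed
  next
    case 2
    then obtain t where "r = \<pi> i * t" by (elim dvdE)
    then have "\<pi> i * (\<Prod>i\<in>I. \<pi> i) = \<pi> i * (p * t)"
      using r by (simp only: mult_ac)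
    then have "(\<Prod>i\<in>I. \<pi> i) = p * t"
      using nz by (rule mpoly_mult_left_cancel)
    then have "\<exists>i\<in>I. \<pi> i dvd p \<and> mpoly_eval (\<lambda>c. c) s (\<pi> i) = 0"
      using insert.prems by (intro insert.IH) auto
    then show ?thesis by blast
  qed
qed

section \<open>Linear forms and the action on polynomials\<close>

locale coordinates = finite_dimensional_vector_space sc "range e"
  for sc :: "'f::field \<Rightarrow> 'v::ab_group_add \<Rightarrow> 'v" and e :: "'n::finite \<Rightarrow> 'v" +
  assumes inj_e: "inj e"
begin

abbreviation linear_form :: "('v \<Rightarrow> 'f) \<Rightarrow> bool" where
  "linear_form l \<equiv> Vector_Spaces.linear sc (*) l"

abbreviation value_at :: "'v \<Rightarrow> ('n, 'f) mpoly \<Rightarrow> 'f" where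
  "value_at v p \<equiv> mpoly_eval (\<lambda>c. c) (\<lambda>j. coord sc e j v) p"

lemma linear_form_coord: "linear_form (coord sc e j)"
  unfolding coord_def using linear_representation[OF independent_Basis span_Basis] .

lemma coord_basis: "coord sc e i (e j) = (if i = j then 1 else 0)"
  by (auto simp: coord_def representation_basis[OF independent_Basis] inj_eq[OF inj_e])

lemma coord_expansion: "v = (\<Sum>i\<in>UNIV. sc (coord sc e i v) (e i))"
proof -
  have "v = (\<Sum>b\<in>range e. sc (representation (range e) v b) b)"
    by (rule sum_representation_eq[OF independent_Basis, symmetric]) (auto simp: span_Basis finite_Basis)
  then show ?thesis
    by (simp add: sum.reindex[OF inj_e] coord_def)
qed

lemma coord_eqI: "v = w" if "\<And>i. coord sc e i v = coord sc e i w"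
  using coord_expansion[of v] coord_expansion[of w] by (simp add: that)

lemma linear_form_expansion:
  assumes "linear_form l"
  shows "l v = (\<Sum>i\<in>UNIV. coord sc e i v * l (e i))"
proof -
  interpret l: Vector_Spaces.linear sc "(*)" l by fact
  show ?thesis
    by (subst coord_expansion) (simp only: l.sum l.scale)
qed

lemma value_at_form_poly: "value_at v (form_poly e l) = l v" if "linear_form l"
  using linear_form_expansion[OF that, of v] by (simp add: form_poly_def mult.commute)

lemma form_poly_coord: "form_poly e (coord sc e j) = Var j"
proof -
  have "form_poly e (coord sc e j) = (\<Sum>i\<in>UNIV. if i = j then Var j else (0 :: ('n, 'f) mpoly))"
    unfolding form_poly_def by (intro sum.cong) (auto simp: coord_basis)
  then show ?thesis by simp
qed

lemma deriv_form_poly: "mpoly_deriv j (form_poly e l) = Const (l (e j))"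
proof -
  have "mpoly_deriv j (form_poly e l) = (\<Sum>i\<in>UNIV. if i = j then Const (l (e i)) else 0)"
    unfolding form_poly_def deriv_sum by (intro sum.cong) auto
  then show ?thesis by simp
qed

lemma prime_form_poly:
  assumes "form_poly e l \<noteq> 0"
  shows "prime_elem (form_poly e l)"
proof -
  obtain k where "l (e k) \<noteq> 0"
    using assms by (force simp: form_poly_def)
  then show ?thesis
    unfolding form_poly_def by (rule linear_form_prime_elem)
qed

lemma hyperplane_kernel:
  assumes "linear_form l" and "l w \<noteq> 0"
  shows "hyperplane sc {v. l v = 0}"
proof -
  interpret l: Vector_Spaces.linear sc "(*)" l by fact
  let ?H = "{v. l v = 0}"
  have sub: "subspace ?H"
    by (auto simp: subspace_def l.zero l.add l.scale)
  have "v \<in> span (insert w ?H)" for v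
  proof -
    have "l (v - sc (l v / l w) w) = 0"
      using assms(2) by (simp add: l.diff l.scale)
    then have "v - sc (l v / l w) w \<in> span ?H"
      by (intro span_base) simp
    then show ?thesis
      by (auto simp: span_insert)
  qed
  then have "dim (insert w ?H) = dim UNIV"
    by (metis UNIV_eq_I dim_span)
  moreover have "w \<notin> span ?H"
    using sub assms(2) by (simp add: span_eq_iff[THEN iffD2])
  ultimately show ?thesis
    using sub by (simp add: hyperplane_def dim_insert del: dim_UNIV)
qed

lemma
  assumes "g \<in> carrier (GL sc)"
  shows GL_bij: "bij g"
    and GL_linear_inv: "Vector_Spaces.linear sc sc (inv_into UNIV g)"
proof -
  interpret GL: group "GL sc"
    by (rule group_GL) unfold_locales
  show "bij g"
    using assms by (simp add: GL_def)
  have "inv\<^bsub>GL sc\<^esub> g \<circ> g = id"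
    using GL.l_inv[OF assms] by (simp add: GL_def)
  then have "(inv\<^bsub>GL sc\<^esub> g) (g x) = x" for x
    by (metis comp_apply id_apply)
  then have eq: "inv\<^bsub>GL sc\<^esub> g = inv_into UNIV g"
    using \<open>bij g\<close> by (metis bij_inv_eq_iff ext)
  show "Vector_Spaces.linear sc sc (inv_into UNIV g)"
    using GL.inv_closed[OF assms] by (simp add: GL_def eq[unfolded GL_def])
qed

lemma linear_form_comp_inv:
  assumes "linear_form l" and "g \<in> carrier (GL sc)"
  shows "linear_form (\<lambda>v. l (inv_into UNIV g v))"
  using Vector_Spaces.linear_compose[OF GL_linear_inv[OF assms(2)] assms(1)] by (simp add: comp_def)

text \<open>
  \<open>form_poly e\<close> intertwines the action on linear functionals with the action on polynomials.
  The latter is defined on the dual basis only, so \<open>l\<close> has to be expanded in it.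
\<close>

lemma poly_action_form_poly:
  assumes "linear_form l"
  shows "poly_action sc e g (form_poly e l) = form_poly e (\<lambda>v. l (inv_into UNIV g v))"
proof -
  have "poly_action sc e g (form_poly e l) =
      (\<Sum>i\<in>UNIV. \<Sum>j\<in>UNIV. Const (coord sc e i (inv_into UNIV g (e j)) * l (e i)) * Var j)"
    by (simp add: poly_action_def form_poly_def sum_distrib_left Const_mult mult_ac)
  also have "\<dots> = (\<Sum>j\<in>UNIV. \<Sum>i\<in>UNIV. Const (coord sc e i (inv_into UNIV g (e j)) * l (e i)) * Var j)"
    by (rule sum.swap)
  also have "\<dots> = (\<Sum>j\<in>UNIV. Const (l (inv_into UNIV g (e j))) * Var j)"
    by (simp only: sum_distrib_right[symmetric] Const_sum[symmetric] linear_form_expansion[OF assms, symmetric])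
  finally show ?thesis
    by (simp add: form_poly_def)
qed

lemma value_at_poly_action:
  assumes "g \<in> carrier (GL sc)"
  shows "value_at v (poly_action sc e g p) = value_at (inv_into UNIV g v) p"
  unfolding poly_action_def eval_subst[OF ident.coefficient_hom_axioms]
  by (simp add: value_at_form_poly linear_form_comp_inv[OF linear_form_coord assms])

lemma poly_action_id: "poly_action sc e id p = p"
  by (simp add: poly_action_def form_poly_coord)

lemma poly_action_comp:
  assumes "g \<in> carrier (GL sc)" and "h \<in> carrier (GL sc)"
  shows "poly_action sc e g (poly_action sc e h p) = poly_action sc e (g \<circ> h) p"
proof -
  have "poly_action sc e g (form_poly e (\<lambda>v. coord sc e j (inv_into UNIV h v))) =
      form_poly e (\<lambda>v. coord sc e j (inv_into UNIV (g \<circ> h) v))" for j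
    using assms by (simp add: poly_action_form_poly linear_form_comp_inv linear_form_coord
        o_inv_distrib[OF GL_bij GL_bij])
  then show ?thesis
    by (simp add: poly_action_def subst_subst)
qed

end

section \<open>Traces and the divisibility theorem\<close>

locale polynomial_invariants = coordinates sc e
  for sc :: "'f::field \<Rightarrow> 'v::ab_group_add \<Rightarrow> 'v" and e :: "'n::finite \<Rightarrow> 'v" +
  fixes G :: "('v \<Rightarrow> 'v) set" and f :: "'n \<Rightarrow> ('n, 'f) mpoly"
  assumes subgroup_G: "subgroup G (GL sc)" and finite_G: "finite G"
    and basic: "basic_invariants sc e G f"
begin

abbreviation act :: "('v \<Rightarrow> 'v) \<Rightarrow> ('n, 'f) mpoly \<Rightarrow> ('n, 'f) mpoly" where
  "act \<equiv> poly_action sc e"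

lemmas act_def = poly_action_def[of sc e]

lemma G_GL: "g \<in> G \<Longrightarrow> g \<in> carrier (GL sc)"
  using subgroup.subset[OF subgroup_G] by blast

lemma id_G: "id \<in> G"
  using subgroup.one_closed[OF subgroup_G] by (simp add: GL_def)

lemma comp_G: "g \<in> G \<Longrightarrow> h \<in> G \<Longrightarrow> g \<circ> h \<in> G"
  using subgroup.m_closed[OF subgroup_G, of g h] by (simp add: GL_def)

lemma act_invariant: "g \<in> G \<Longrightarrow> act g (mpoly_subst f P) = mpoly_subst f P"
  using basic by (auto simp: basic_invariants_def invariants_def)

lemma translate_G:
  assumes "g \<in> G"
  shows "bij_betw ((\<circ>) g) G G"
proof -
  have "inj_on ((\<circ>) g) G"
    using GL_bij[OF G_GL[OF assms]] by (auto intro!: inj_onI simp: fun.inj_map_strong bij_def inj_def fun_eq_iff)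
  moreover have "(\<circ>) g ` G \<subseteq> G"
    using comp_G[OF assms] by auto
  ultimately show ?thesis
    using endo_inj_surj[OF finite_G] by (auto simp: bij_betw_def)
qed

lemma trace_polynomial: "\<exists>P. (\<Sum>g\<in>G. act g p) = mpoly_subst f P"
proof -
  have "act h (\<Sum>g\<in>G. act g p) = (\<Sum>g\<in>G. act g p)" if "h \<in> G" for h
  proof -
    have "act h (\<Sum>g\<in>G. act g p) = (\<Sum>g\<in>G. act (h \<circ> g) p)"
      using poly_action_comp[OF G_GL[OF that] G_GL] by (simp add: act_def)
    also have "\<dots> = (\<Sum>g\<in>G. act g p)"
      by (rule sum.reindex_bij_betw[OF translate_G[OF that], of "\<lambda>g. act g p"])
    finally show ?thesis .
  qed
  then have "(\<Sum>g\<in>G. act g p) \<in> invariants sc e G"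
    by (simp add: invariants_def)
  then show ?thesis
    using basic by (auto simp: basic_invariants_def)
qed

text \<open>
  These are the pairs \<open>(V, D)\<close> that come from a polynomial \<open>q(z)\<close> with coefficients in the polynomial
  ring: \<open>V g = q(g \<cdot> x)\<close>, and \<open>D g j\<close> is the derivative of \<open>q(g \<cdot> x)\<close> with respect to the \<open>j\<close>-th
  variable, taken with the coefficients of \<open>q\<close> held constant.  The factor \<open>c\<close> below is such a
  coefficient and therefore stays outside the derivative.
\<close>

inductive jet :: "(('v \<Rightarrow> 'v) \<Rightarrow> ('n, 'f) mpoly) \<Rightarrow> (('v \<Rightarrow> 'v) \<Rightarrow> 'n \<Rightarrow> ('n, 'f) mpoly) \<Rightarrow> bool" where
  base: "jet (\<lambda>g. c * act g p) (\<lambda>g j. c * mpoly_deriv j (act g p))"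
| add: "jet V D \<Longrightarrow> jet V' D' \<Longrightarrow> jet (\<lambda>g. V g + V' g) (\<lambda>g j. D g j + D' g j)"

lemma jet_cong:
  assumes "jet V D" and "\<And>g. V g = V' g" and "\<And>g j. D g j = D' g j"
  shows "jet V' D'"
proof -
  have "V = V'" and "D = D'"
    using assms(2,3) by (auto simp: fun_eq_iff)
  with assms(1) show ?thesis by simp
qed

lemma jet_mult_base:
  assumes "jet V D"
  shows "jet (\<lambda>g. c * act g p * V g) (\<lambda>g j. c * mpoly_deriv j (act g p) * V g + c * act g p * D g j)"
  using assms
proof (induction rule: jet.induct)
  case (base c' q)
  show ?case
    by (rule jet_cong[OF jet.base[of "c * c'" "p * q"]]) (simp_all add: act_def algebra_simps)
next
  case (add V D V' D')
  show ?case
    by (rule jet_cong[OF jet.add[OF add.IH]]) (simp_all add: algebra_simps)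
qed

lemma jet_mult:
  assumes "jet V D" and "jet V' D'"
  shows "jet (\<lambda>g. V g * V' g) (\<lambda>g j. D g j * V' g + V g * D' g j)"
  using assms(1)
proof (induction rule: jet.induct)
  case (base c p)
  show ?case by (rule jet_mult_base[OF assms(2)])
next
  case (add V1 D1 V2 D2)
  show ?case
    by (rule jet_cong[OF jet.add[OF add.IH]]) (simp_all add: algebra_simps)
qed

text \<open>
  The jet of \<open>z\<^sub>k - c\<close>.
\<close>

lemma jet_Var_diff: "jet (\<lambda>g. act g (Var k) - c) (\<lambda>g j. mpoly_deriv j (act g (Var k)))"
  by (rule jet_cong[OF jet.add[OF jet.base[of 1 "Var k"] jet.base[of "- c" 1]]])
     (simp_all add: act_def)

text \<open>
  The trace of \<open>p\<close> is an invariant, hence a polynomial in the \<open>f\<^sub>i\<close>, and the chain rule writes its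
  gradient in terms of the gradients of the \<open>f\<^sub>i\<close>.  The coefficients \<open>c\<close> stay
  outside the derivative and only scale this combination.
\<close>

lemma sum_jet_in_row_span:
  assumes "jet V D"
  shows "\<exists>b. \<forall>j. (\<Sum>g\<in>G. D g j) = (\<Sum>i\<in>UNIV. b i * mpoly_deriv j (f i))"
  using assms
proof (induction rule: jet.induct)
  case (base c p)
  obtain P where P: "(\<Sum>g\<in>G. act g p) = mpoly_subst f P"
    using trace_polynomial by blast
  have "(\<Sum>g\<in>G. c * mpoly_deriv j (act g p)) =
      (\<Sum>i\<in>UNIV. (c * mpoly_subst f (mpoly_deriv i P)) * mpoly_deriv j (f i))" for j
  proof -
    have "(\<Sum>g\<in>G. c * mpoly_deriv j (act g p)) = c * mpoly_deriv j (mpoly_subst f P)"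
      by (simp add: sum_distrib_left flip: P)
    then show ?thesis
      by (simp add: deriv_subst sum_distrib_left mult.assoc)
  qed
  then show ?case
    by (intro exI[of _ "\<lambda>i. c * mpoly_subst f (mpoly_deriv i P)"]) simp
next
  case (add V D V' D')
  then obtain b b' where
    "\<And>j. (\<Sum>g\<in>G. D g j) = (\<Sum>i\<in>UNIV. b i * mpoly_deriv j (f i))"
    "\<And>j. (\<Sum>g\<in>G. D' g j) = (\<Sum>i\<in>UNIV. b' i * mpoly_deriv j (f i))"
    by blast
  then have "\<forall>j. (\<Sum>g\<in>G. D g j + D' g j) = (\<Sum>i\<in>UNIV. (b i + b' i) * mpoly_deriv j (f i))"
    by (simp add: sum.distrib distrib_right)
  then show ?case
    by (intro exI[of _ "\<lambda>i. b i + b' i"])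
qed

text \<open>
  Interpolation at the points \<open>g \<cdot> x\<close> by the product of the \<open>(z\<^sub>k - h \<cdot> x\<^sub>k)\<^sup>2\<close> over \<open>h \<in> B\<close>, where
  \<open>k = k(h)\<close>.  The squares make the derivatives at the points \<open>h \<cdot> x\<close> vanish too.
\<close>

lemma separating_jet:
  assumes "finite B"
  shows "\<exists>V D. jet V D \<and> V id = (\<Prod>h\<in>B. (Var (k h) - act h (Var (k h)))\<^sup>2) \<and>
    (\<forall>h\<in>B. V h = 0 \<and> (\<forall>j. D h j = 0))"
  using assms
proof (induction B rule: finite_induct)
  case empty
  have "jet (\<lambda>g. 1) (\<lambda>g j. 0)"
    by (rule jet_cong[OF jet.base[of 1 1]]) (simp_all add: act_def)
  then show ?case by force
next
  case (insert h B)
  then obtain V D where VD: "jet V D" "V id = (\<Prod>h\<in>B. (Var (k h) - act h (Var (k h)))\<^sup>2)"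
    "\<forall>h\<in>B. V h = 0 \<and> (\<forall>j. D h j = 0)"
    by blast
  let ?X = "\<lambda>g. act g (Var (k h)) - act h (Var (k h))"
  let ?X' = "\<lambda>g j. mpoly_deriv j (act g (Var (k h)))"
  let ?V = "\<lambda>g. ?X g * ?X g * V g"
  let ?D = "\<lambda>g j. (?X' g j * ?X g + ?X g * ?X' g j) * V g + ?X g * ?X g * D g j"
  have "jet ?V ?D"
    by (intro jet_mult jet_Var_diff VD(1))
  moreover have "?V id = (\<Prod>h\<in>insert h B. (Var (k h) - act h (Var (k h)))\<^sup>2)"
    by (simp only: prod.insert[OF insert.hyps] power2_eq_square VD(2) poly_action_id)
  moreover have "\<forall>h'\<in>insert h B. ?V h' = 0 \<and> (\<forall>j. ?D h' j = 0)"
    using VD(3) by auto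
  ultimately show ?case by blast
qed

text \<open>
  The separating jet, multiplied by the jet of \<open>z\<^sub>m - x\<^sub>m\<close>, has derivative \<open>0\<close> at every \<open>g \<noteq> 1\<close>, and
  \<open>d\<close> times the \<open>m\<close>-th unit vector at \<open>g = 1\<close>.  Letting \<open>m\<close> vary shows that the product of some
  matrix with the Jacobian matrix is \<open>d\<close> times the identity.  The freedom
  in choosing \<open>k\<close> is what makes this divisibility useful.
\<close>

theorem jacobian_det_dvd:
  "jacobian_det f dvd
    (\<Prod>h\<in>G - {id}. (Var (k h) - act h (Var (k h))) ^ (2 * CARD('n)))"
proof -
  define d where "d = (\<Prod>h\<in>G - {id}. (Var (k h) - act h (Var (k h)))\<^sup>2)"
  obtain V D where VD: "jet V D" "V id = d"
    "\<And>h j. h \<in> G \<Longrightarrow> h \<noteq> id \<Longrightarrow> V h = 0" "\<And>h j. h \<in> G \<Longrightarrow> h \<noteq> id \<Longrightarrow> D h j = 0"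
    using separating_jet[of "G - {id}" k] finite_G unfolding d_def by auto
  have "\<exists>b. \<forall>j. (\<Sum>i\<in>UNIV. b i * mpoly_deriv j (f i)) = (if j = m then d else 0)" for m
  proof -
    have "(\<Sum>g\<in>G. D g j * (act g (Var m) - Var m) + V g * mpoly_deriv j (act g (Var m))) =
        (if j = m then d else 0)" for j
    proof -
      have "(\<Sum>g\<in>G. D g j * (act g (Var m) - Var m) + V g * mpoly_deriv j (act g (Var m))) =
          (\<Sum>g\<in>{id}. D g j * (act g (Var m) - Var m) + V g * mpoly_deriv j (act g (Var m)))"
        using id_G finite_G VD(3,4) by (intro sum.mono_neutral_right) auto
      then show ?thesis
        by (simp add: poly_action_id VD(2))
    qed
    moreover obtain b where "\<forall>j. (\<Sum>g\<in>G. D g j * (act g (Var m) - Var m) +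
        V g * mpoly_deriv j (act g (Var m))) = (\<Sum>i\<in>UNIV. b i * mpoly_deriv j (f i))"
      using sum_jet_in_row_span[OF jet_mult[OF VD(1) jet_Var_diff[of m "Var m"]]] by blast
    ultimately show ?thesis
      by (intro exI[of _ b]) simp
  qed
  then obtain b where b: "\<And>m j. (\<Sum>i\<in>UNIV. b m i * mpoly_deriv j (f i)) = (if j = m then d else 0)"
    by metis
  have "det ((\<chi> m i. b m i) ** (\<chi> i j. mpoly_deriv j (f i))) = d ^ CARD('n)"
    by (subst det_diagonal) (simp_all add: matrix_matrix_mult_def b)
  then have "jacobian_det f dvd d ^ CARD('n)"
    by (metis det_mul dvd_triv_right jacobian_det_def)
  then show ?thesis
    by (simp add: d_def prod_power_distrib power_mult)
qed

section \<open>Reflecting hyperplanes\<close>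

text \<open>
  \<open>Var k - h \<cdot> Var k\<close> is the linear form \<open>v \<mapsto> (v - w)\<^sub>k\<close> where \<open>w\<close> is the image of \<open>v\<close> under the inverse
  of \<open>h\<close>; it measures in the \<open>k\<close>-th coordinate how far \<open>v\<close> is from being fixed by \<open>h\<close>.
\<close>

lemma defect_form:
  assumes "h \<in> G"
  shows "Var k - act h (Var k) =
      form_poly e (\<lambda>v. coord sc e k v - coord sc e k (inv_into UNIV h v))" (is ?form)
    and "linear_form (\<lambda>v. coord sc e k v - coord sc e k (inv_into UNIV h v))" (is ?linear)
proof -
  have "act h (Var k) = form_poly e (\<lambda>v. coord sc e k (inv_into UNIV h v))"
    using poly_action_form_poly[OF linear_form_coord] by (simp add: form_poly_coord)
  then have "Var k - act h (Var k) = form_poly e (coord sc e k) -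
      form_poly e (\<lambda>v. coord sc e k (inv_into UNIV h v))"
    by (simp add: form_poly_coord)
  then show ?form
    by (simp add: form_poly_def Const_diff left_diff_distrib sum_subtractf)
  interpret c: Vector_Spaces.linear sc "(*)" "coord sc e k"
    by (rule linear_form_coord)
  interpret ch: Vector_Spaces.linear sc "(*)" "\<lambda>v. coord sc e k (inv_into UNIV h v)"
    by (rule linear_form_comp_inv[OF linear_form_coord G_GL[OF assms]])
  show ?linear
    by unfold_locales (simp_all add: c.add ch.add c.scale ch.scale algebra_simps)
qed

lemma value_at_defect:
  assumes "h \<in> G"
  shows "value_at v (Var k - act h (Var k)) = coord sc e k v - coord sc e k (inv_into UNIV h v)"
  using assms by (simp add: value_at_poly_action G_GL)

lemma fixed_if_defects_vanish:
  assumes "h \<in> G" and "\<And>k. value_at v (Var k - act h (Var k)) = 0"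
  shows "h v = v"
proof -
  have "v = inv_into UNIV h v"
    using assms by (intro coord_eqI) (simp add: value_at_poly_action G_GL)
  then show ?thesis
    using GL_bij[OF G_GL[OF assms(1)]] by (metis bij_inv_eq_iff)
qed

text \<open>
  Applying \<open>jacobian_det_dvd\<close> to one choice of coordinates produces a linear form \<open>\<pi>\<close> that divides the
  Jacobian determinant and vanishes at \<open>v\<close>.  Applying it to the other choices produces an element of
  \<open>G\<close> that fixes the kernel of \<open>\<pi>\<close> pointwise.
\<close>

lemma reflecting_hyperplane_through_zero:
  assumes "value_at v (jacobian_det f) = 0"
  shows "\<exists>H. reflecting_hyperplane sc G H \<and> v \<in> H"
proof -
  let ?N = "2 * CARD('n)"
  have "\<exists>k. Var k - act h (Var k) \<noteq> 0" if "h \<in> G - {id}" for h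
  proof (rule ccontr)
    assume "\<not> (\<exists>k. Var k - act h (Var k) \<noteq> 0)"
    then have "h w = w" for w
      using that by (intro fixed_if_defects_vanish) auto
    with that show False by auto
  qed
  then obtain k where k: "\<And>h. h \<in> G - {id} \<Longrightarrow> Var (k h) - act h (Var (k h)) \<noteq> 0"
    by metis
  define \<pi> where "\<pi> h = Var (k h) - act h (Var (k h))" for h
  have prime: "prime_elem (\<pi> h)" if "h \<in> G - {id}" for h
  proof -
    have "h \<in> G" using that by blast
    show ?thesis
      unfolding \<pi>_def defect_form(1)[OF \<open>h \<in> G\<close>]
      by (rule prime_form_poly) (use k[OF that] in \<open>simp only: defect_form(1)[OF \<open>h \<in> G\<close>] not_False_eq_True\<close>)
  qed
  have "\<exists>z\<in>(G - {id}) \<times> {..<?N}.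
      \<pi> (fst z) dvd jacobian_det f \<and> value_at v (\<pi> (fst z)) = 0"
  proof (rule prime_divisor_at_zero)
    \<comment> \<open>Powers of primes are written as products of primes, indexed by the copies of each factor.\<close>
    have "(\<Prod>h\<in>G - {id}. \<pi> h ^ ?N) = (\<Prod>h\<in>G - {id}. \<Prod>i<?N. \<pi> h)"
      by (simp only: prod_constant card_lessThan)
    also have "\<dots> = (\<Prod>z\<in>(G - {id}) \<times> {..<?N}. \<pi> (fst z))"
      by (simp only: prod.cartesian_product case_prod_unfold)
    finally show "jacobian_det f dvd (\<Prod>z\<in>(G - {id}) \<times> {..<?N}. \<pi> (fst z))"
      using jacobian_det_dvd[of k] by (simp only: \<pi>_def)
    show "prime_elem (\<pi> (fst z))" if "z \<in> (G - {id}) \<times> {..<?N}" for z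
      using that by (intro prime) auto
  qed (use finite_G assms in auto)
  then obtain h where h: "h \<in> G" "h \<noteq> id" and dvd: "\<pi> h dvd jacobian_det f"
    and zero: "value_at v (\<pi> h) = 0"
    by auto
  have prime_h: "prime_elem (\<pi> h)"
    using h by (intro prime) blast
  \<comment> \<open>Otherwise each \<open>g\<close> has a coordinate whose form \<open>\<pi> h\<close> does not divide, and these
    coordinates contradict the divisibility.\<close>
  have "\<exists>g\<in>G - {id}. \<forall>k. \<pi> h dvd Var k - act g (Var k)"
  proof (rule ccontr)
    assume "\<not> ?thesis"
    then have "\<forall>g\<in>G - {id}. \<exists>k. \<not> \<pi> h dvd Var k - act g (Var k)"
      by blast
    then obtain k' where k': "\<And>g. g \<in> G - {id} \<Longrightarrow> \<not> \<pi> h dvd Var (k' g) - act g (Var (k' g))"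
      by metis
    have "\<pi> h dvd (\<Prod>g\<in>G - {id}. (Var (k' g) - act g (Var (k' g))) ^ ?N)"
      using dvd jacobian_det_dvd by (rule dvd_trans)
    then obtain g where "g \<in> G - {id}"
      and "\<pi> h dvd (Var (k' g) - act g (Var (k' g))) ^ ?N"
      by (rule prime_elem_dvd_prodE[OF prime_h])
    then show False
      using k' prime_elem_dvd_power[OF prime_h] by blast
  qed
  then obtain g where g: "g \<in> G" "g \<noteq> id" and g_dvd: "\<And>k. \<pi> h dvd Var k - act g (Var k)"
    by blast
  let ?l = "\<lambda>w. coord sc e (k h) w - coord sc e (k h) (inv_into UNIV h w)"
  have value_\<pi>: "value_at w (\<pi> h) = ?l w" for w
    unfolding \<pi>_def by (rule value_at_defect[OF h(1)])
  have "\<pi> h = form_poly e ?l"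
    unfolding \<pi>_def by (rule defect_form(1)[OF h(1)])
  moreover have "\<pi> h \<noteq> 0"
    using k h by (simp add: \<pi>_def)
  ultimately obtain w where "?l w \<noteq> 0"
    by (force simp: form_poly_def)
  then have "hyperplane sc {w. ?l w = 0}"
    using defect_form(2)[OF h(1)] by (rule hyperplane_kernel[rotated])
  moreover have "g w = w" if "?l w = 0" for w
  proof (rule fixed_if_defects_vanish[OF g(1)])
    fix k
    obtain q where "Var k - act g (Var k) = \<pi> h * q"
      using g_dvd[of k] by (elim dvdE)
    then show "value_at w (Var k - act g (Var k)) = 0"
      by (simp only: ident.eval_mult value_\<pi> that mult_zero_left)
  qed
  ultimately have "reflecting_hyperplane sc G {w. ?l w = 0}"
    using g by (auto simp: reflecting_hyperplane_def pointwise_stabilizer_def)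
  then show ?thesis
    using zero by (auto simp: value_\<pi>)
qed

text \<open>
  The matrix \<open>?C\<close> of the inverse of \<open>g\<close> satisfies \<open>?A ** ?C = ?A\<close> by the chain rule, because \<open>g\<close> fixes both
  the point \<open>v\<close> and the polynomials \<open>f i\<close>.  If \<open>?A\<close> were invertible, \<open>?C\<close> would be the identity matrix.
\<close>

lemma jacobian_det_zero_at_fixed_point:
  assumes "g \<in> G" and "g \<noteq> id" and "g v = v"
  shows "value_at v (jacobian_det f) = 0"
proof (rule ccontr)
  let ?A = "\<chi> i j. value_at v (mpoly_deriv j (f i))"
  let ?C = "\<chi> k j. coord sc e k (inv_into UNIV g (e j))"
  assume "value_at v (jacobian_det f) \<noteq> 0"
  then have "invertible ?A"
    by (simp add: jacobian_det_def ident.eval_det invertible_det_nz)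
  have inv_v: "inv_into UNIV g v = v"
    using assms GL_bij[OF G_GL[OF assms(1)]] by (metis bij_inv_eq_iff)
  have "?A $ i $ j = (?A ** ?C) $ i $ j" for i j
  proof -
    have "mpoly_deriv j (f i) = mpoly_deriv j (act g (f i))"
      using act_invariant[OF assms(1), of "Var i"] by simp
    also have "\<dots> = (\<Sum>k\<in>UNIV. act g (mpoly_deriv k (f i)) *
        Const (coord sc e k (inv_into UNIV g (e j))))"
      by (simp only: act_def deriv_subst deriv_form_poly)
    finally have "mpoly_deriv j (f i) = (\<Sum>k\<in>UNIV. act g (mpoly_deriv k (f i)) *
        Const (coord sc e k (inv_into UNIV g (e j))))" .
    then have "value_at v (mpoly_deriv j (f i)) = (\<Sum>k\<in>UNIV. value_at v (mpoly_deriv k (f i)) *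
        coord sc e k (inv_into UNIV g (e j)))"
      by (simp add: value_at_poly_action[OF G_GL[OF assms(1)]] inv_v)
    then show ?thesis
      by (simp add: matrix_matrix_mult_def)
  qed
  then have "?A = ?A ** ?C"
    by (simp only: vec_eq_iff) blast
  moreover obtain B where B: "B ** ?A = mat 1"
    using \<open>invertible ?A\<close> unfolding invertible_left_inverse by blast
  ultimately have "mat 1 = B ** (?A ** ?C)"
    by (simp only:)
  then have "mat 1 = ?C"
    by (simp only: matrix_mul_assoc B matrix_mul_lid)
  then have coord: "coord sc e k (inv_into UNIV g (e j)) = (if k = j then 1 else 0)" for k j
    by (simp add: vec_eq_iff mat_def)
  interpret g_inv: Vector_Spaces.linear sc sc "inv_into UNIV g"
    by (rule GL_linear_inv[OF G_GL[OF assms(1)]])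
  have "inv_into UNIV g (e j) = e j" for j
    by (rule coord_eqI) (simp add: coord coord_basis)
  then have "inv_into UNIV g w = w" for w
    by (subst (1 2) coord_expansion[of w]) (simp only: g_inv.sum g_inv.scale)
  then have "g w = w" for w
    using GL_bij[OF G_GL[OF assms(1)]] by (metis bij_inv_eq_iff)
  then show False
    using assms(2) by auto
qed

end

theorem corollary9:
  fixes sc :: "'f::field \<Rightarrow> 'v::ab_group_add \<Rightarrow> 'v"
    and e :: "'n::finite \<Rightarrow> 'v"
    and G :: "('v \<Rightarrow> 'v) set"
    and f :: "'n \<Rightarrow> ('n, 'f) mpoly"
  assumes "finite_dimensional_vector_space sc (range e)" and "inj e"
    and "subgroup G (GL sc)" and "finite G"
    and "basic_invariants sc e G f"
  shows "zero_set sc e (jacobian_det f) = \<Union> {H. reflecting_hyperplane sc G H}"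
proof -
  interpret finite_dimensional_vector_space sc "range e" by fact
  interpret polynomial_invariants sc e G f
    by (intro polynomial_invariants.intro coordinates.intro coordinates_axioms.intro
        polynomial_invariants_axioms.intro assms)
  show ?thesis
  proof (intro equalityI subsetI)
    fix v assume "v \<in> zero_set sc e (jacobian_det f)"
    then show "v \<in> \<Union> {H. reflecting_hyperplane sc G H}"
      using reflecting_hyperplane_through_zero[of v] by (auto simp: zero_set_def)
  next
    fix v assume "v \<in> \<Union> {H. reflecting_hyperplane sc G H}"
    then obtain H where "v \<in> H" and "pointwise_stabilizer G H \<noteq> {id}"
      by (auto simp: reflecting_hyperplane_def)
    moreover have "id \<in> pointwise_stabilizer G H"
      using id_G by (simp add: pointwise_stabilizer_def)
    ultimately obtain g where "g \<in> G" "g \<noteq> id" "g v = v"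
      unfolding pointwise_stabilizer_def by blast
    then show "v \<in> zero_set sc e (jacobian_det f)"
      using jacobian_det_zero_at_fixed_point by (simp add: zero_set_def)
  qed
qed

end
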